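(* Let $\mathcal{H}$ be a real Hilbert space, let $f\in\Gamma_0(\mathcal{H})$ be Legendre, let $m\ge 1$, and let $\mathcal{S}=\{p_0,p_1,\dots,p_m\}\subseteq\operatorname{dom} f$. Suppose that $p_0,p_1,\dots,p_m$ are affinely independent and that $\operatorname{aff}(\mathcal{S})\subseteq\operatorname{int}\operatorname{dom} f^*$. Then $\overrightarrow{CC}^{ps}_f(\mathcal{S})\neq\varnothing$; moreover, $\overrightarrow{CC}^{ps}_f(\mathcal{S})$ is the singleton whose unique element is $$\nabla f^*\big(p_0+\alpha_1(p_1-p_0)+\cdots+\alpha_m(p_m-p_0)\big),$$ where $$\begin{pmatrix}\alpha_1\\ \vdots\\ \alpha_m\end{pmatrix}=G(p_1-p_0,\dots,p_m-p_0)^{-1}\begin{pmatrix}\eta_1-\langle p_0,p_1-p_0\rangle\\ \vdots\\ \eta_m-\langle p_0,p_m-p_0\rangle\end{pmatrix}$$ and $\eta_i=f(p_i)-f(p_0)$ for every $i\in\{1,\dots,m\}$.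
   Context: $\Gamma_0(\mathcal{H})$ is the set of proper closed convex functions $\mathcal{H}\to\,]-\infty,+\infty]$; $f^*$ is the Fenchel conjugate; $\operatorname{aff}$ denotes affine hull. The Gram matrix $G(a_1,\dots,a_m)$ is the $m\times m$ matrix with $(i,j)$ entry $\langle a_i,a_j\rangle$. $f\in\Gamma_0(\mathcal{H})$ is Legendre if it is essentially smooth ($\operatorname{dom}\partial f=\operatorname{int}\operatorname{dom} f\neq\varnothing$, $f$ is Gâteaux differentiable on $\operatorname{int}\operatorname{dom} f$, and $\|\nabla f(x_k)\|\to+\infty$ for every sequence $(x_k)$ in $\operatorname{int}\operatorname{dom} f$ converging to a point of $\operatorname{bd}\operatorname{dom} f$) and essentially strictly convex ($(\partial f)^{-1}$ is locally bounded on its domain and $f$ is strictly convex on every convex subset of $\operatorname{dom}\partial f$). If $f$ is Legendre then so is $f^*$, and $\nabla f:\operatorname{int}\operatorname{dom} f\to\operatorname{int}\operatorname{dom} f^*$ is a bijection with inverse $\nabla f^*$. The Bregman distance is $D_f(x,y)=f(x)-f(y)-\langle\nabla f(y),x-y\rangle$ if $y\in\operatorname{int}\operatorname{dom} f$, and $+\infty$ otherwise. $\overrightarrow{E}_f(\mathcal{S})=\{y\in\operatorname{int}\operatorname{dom} f:\ D_f(p_0,y)=D_f(p_1,y)=\cdots=D_f(p_m,y)\}$. The forward Bregman pseudo-circumcenter set of $\mathcal{S}$ is $\overrightarrow{CC}^{ps}_f(\mathcal{S})=\nabla f^*(\operatorname{aff}(\mathcal{S}))\cap\overrightarrow{E}_f(\mathcal{S})$.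 *)

theory Defs
  imports "HOL-Analysis.Analysis"
begin

definition eff_domain :: "('a \<Rightarrow> ereal) \<Rightarrow> 'a set" where
  "eff_domain f = {x. f x < \<infinity>}"

definition ereal_epigraph :: "('a \<Rightarrow> ereal) \<Rightarrow> ('a \<times> real) set" where
  "ereal_epigraph f = {(x, r). f x \<le> ereal r}"

definition proper_closed_convex :: "('a::real_inner \<Rightarrow> ereal) \<Rightarrow> bool" where
  "proper_closed_convex f \<longleftrightarrow>
     (\<forall>x. f x \<noteq> -\<infinity>) \<and> eff_domain f \<noteq> {} \<and>
     closed (ereal_epigraph f) \<and> convex (ereal_epigraph f)"

definition fenchel_conjugate :: "('a::real_inner \<Rightarrow> ereal) \<Rightarrow> 'a \<Rightarrow> ereal" where
  "fenchel_conjugate f u = (SUP x. ereal (x \<bullet> u) - f x)"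

definition subdiff :: "('a::real_inner \<Rightarrow> ereal) \<Rightarrow> 'a \<Rightarrow> 'a set" where
  "subdiff f x = {u. \<forall>y. f x + ereal (u \<bullet> (y - x)) \<le> f y}"

definition subdiff_domain :: "('a::real_inner \<Rightarrow> ereal) \<Rightarrow> 'a set" where
  "subdiff_domain f = {x. subdiff f x \<noteq> {}}"

text \<open>In a Hilbert space a Gateaux derivative, being a bounded linear functional, is identified
  with its Riesz representative. At a point of the interior of the domain the values
  \<open>f (x + t *\<^sub>R h)\<close> are finite for small \<open>t\<close>, so \<open>real_of_ereal\<close> is harmless there
  (for functions that never take the value \<open>-\<infinity>\<close>).\<close>

definition has_gateaux_gradient :: "('a::real_inner \<Rightarrow> ereal) \<Rightarrow> 'a \<Rightarrow> 'a \<Rightarrow> bool" where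
  "has_gateaux_gradient f x u \<longleftrightarrow>
     x \<in> interior (eff_domain f) \<and>
     (\<forall>h. ((\<lambda>t. (real_of_ereal (f (x + t *\<^sub>R h)) - real_of_ereal (f x)) / t)
            \<longlongrightarrow> u \<bullet> h) (at 0))"

definition gateaux_gradient :: "('a::real_inner \<Rightarrow> ereal) \<Rightarrow> 'a \<Rightarrow> 'a" where
  "gateaux_gradient f x = (THE u. has_gateaux_gradient f x u)"

definition essentially_smooth :: "('a::real_inner \<Rightarrow> ereal) \<Rightarrow> bool" where
  "essentially_smooth f \<longleftrightarrow>
     subdiff_domain f = interior (eff_domain f) \<and>
     interior (eff_domain f) \<noteq> {} \<and>
     (\<forall>x \<in> interior (eff_domain f). \<exists>u. has_gateaux_gradient f x u) \<and>
     (\<forall>X x. (\<forall>k. X k \<in> interior (eff_domain f)) \<and> X \<longlonglongrightarrow> x \<and> x \<in> frontier (eff_domain f) \<longrightarrow>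
        filterlim (\<lambda>k. norm (gateaux_gradient f (X k))) at_top sequentially)"

text \<open>The first conjunct is local boundedness of \<open>(\<partial>f)\<^sup>-\<^sup>1\<close> at each point \<open>u\<close> of its
  domain: the image under \<open>(\<partial>f)\<^sup>-\<^sup>1\<close> of some neighbourhood \<open>U\<close> of \<open>u\<close> is bounded.\<close>

definition essentially_strictly_convex :: "('a::real_inner \<Rightarrow> ereal) \<Rightarrow> bool" where
  "essentially_strictly_convex f \<longleftrightarrow>
     (\<forall>u \<in> (\<Union>x. subdiff f x). \<exists>U. open U \<and> u \<in> U \<and> bounded {x. subdiff f x \<inter> U \<noteq> {}}) \<and>
     (\<forall>C. convex C \<and> C \<subseteq> subdiff_domain f \<longrightarrow>
        (\<forall>x\<in>C. \<forall>y\<in>C. \<forall>t. x \<noteq> y \<and> 0 < t \<and> t < 1 \<longrightarrow>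
           f ((1 - t) *\<^sub>R x + t *\<^sub>R y) < ereal (1 - t) * f x + ereal t * f y))"

definition legendre :: "('a::real_inner \<Rightarrow> ereal) \<Rightarrow> bool" where
  "legendre f \<longleftrightarrow> essentially_smooth f \<and> essentially_strictly_convex f"

definition bregman_distance :: "('a::real_inner \<Rightarrow> ereal) \<Rightarrow> 'a \<Rightarrow> 'a \<Rightarrow> ereal" where
  "bregman_distance f x y =
     (if y \<in> interior (eff_domain f)
      then f x - f y - ereal (gateaux_gradient f y \<bullet> (x - y)) else \<infinity>)"

definition forward_equidistant :: "('a::real_inner \<Rightarrow> ereal) \<Rightarrow> 'a set \<Rightarrow> 'a set" where
  "forward_equidistant f S =
     {y \<in> interior (eff_domain f).
        \<forall>p\<in>S. \<forall>q\<in>S. bregman_distance f p y = bregman_distance f q y}"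

text \<open>\<open>\<nabla>f\<^sup>*\<close> is an operator with domain \<open>int dom f\<^sup>*\<close>, so the image of \<open>aff S\<close> under it only
  involves points of that domain; \<open>gateaux_gradient\<close> has an unspecified value elsewhere.\<close>

definition forward_pseudo_circumcenters :: "('a::real_inner \<Rightarrow> ereal) \<Rightarrow> 'a set \<Rightarrow> 'a set" where
  "forward_pseudo_circumcenters f S =
     gateaux_gradient (fenchel_conjugate f)
       ` (affine hull S \<inter> interior (eff_domain (fenchel_conjugate f)))
     \<inter> forward_equidistant f S"

definition gram_matrix :: "('m::finite \<Rightarrow> 'a::real_inner) \<Rightarrow> real ^ 'm ^ 'm" where
  "gram_matrix a = (\<chi> i j. a i \<bullet> a j)"

end

theory Submission imports Defs begin

text \<open>At \<open>y = \<nabla>f\<^sup>*(u)\<close> with \<open>u \<in> int dom f\<^sup>*\<close> one has \<open>\<nabla>f(y) = u\<close>, so equality of \<open>D\<^sub>f(p\<^sub>i, y)\<close> and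
  \<open>D\<^sub>f(p\<^sub>0, y)\<close> becomes the linear equation \<open>\<langle>u, p\<^sub>i - p\<^sub>0\<rangle> = \<eta>\<^sub>i\<close>; for \<open>u\<close> in the affine hull this is a
  linear system with the Gram matrix, which is invertible by affine independence.

  The inversion \<open>\<nabla>f \<circ> \<nabla>f\<^sup>* = id\<close> is obtained from the sets where \<open>\<langle>z, u\<rangle> - f(z) \<ge> c\<close>. They are closed and
  convex, and bounded when \<open>u \<in> int dom f\<^sup>*\<close> because they are weakly bounded. In a Hilbert space such sets
  decrease to a nonempty set. This yields both a maximizer of \<open>\<langle>z, u\<rangle> - f(z)\<close>, unique by essential strict
  convexity, and, in place of a weak compactness argument, the Gateaux derivative of \<open>f\<^sup>*\<close> at \<open>u\<close>.\<close>

section \<open>Hilbert space tools: nested convex sets and uniform boundedness\<close>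

text \<open>Points of nearly least norm form a Cauchy sequence: the least norms \<open>d n\<close>
  increase and are bounded, so the parallelogram law forces late points together, and their limit
  lies in every \<open>C n\<close>.\<close>

lemma nested_closed_convex_Inter_nonempty:
  fixes C :: "nat \<Rightarrow> 'a::{real_inner, complete_space} set"
  assumes clo: "\<And>n. closed (C n)" and cvx: "\<And>n. convex (C n)" and ne: "\<And>n. C n \<noteq> {}"
    and dec: "decseq C" and bdd: "bounded (C 0)"
  shows "(\<Inter>n. C n) \<noteq> {}"
proof -
  define d where "d n = Inf (norm ` C n)" for n
  have bb: "bdd_below (norm ` C n)" for n
    by (rule bdd_belowI[of _ 0]) auto
  have lower: "d n \<le> norm x" if "x \<in> C n" for n x
    unfolding d_def using bb that by (intro cInf_lower) auto
  have d_nonneg: "0 \<le> d n" for n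
    unfolding d_def by (intro cInf_greatest) (use ne in auto)
  have "\<exists>x \<in> C n. norm x < d n + 1 / Suc n" for n
  proof -
    have "Inf (norm ` C n) < d n + 1 / Suc n"
      by (simp add: d_def)
    then show ?thesis
      using cInf_lessD[of "norm ` C n"] ne by blast
  qed
  then obtain x where x: "\<And>n. x n \<in> C n" "\<And>n. norm (x n) < d n + 1 / Suc n"
    by metis
  have sub: "C m \<subseteq> C n" if "n \<le> m" for m n
    using dec that by (auto simp: decseq_def)
  have "incseq d"
  proof (rule incseq_SucI)
    fix n
    show "d n \<le> d (Suc n)"
      unfolding d_def using ne bb sub[of n "Suc n"] by (intro cInf_superset_mono) auto
  qed
  obtain B where B: "\<And>z. z \<in> C 0 \<Longrightarrow> norm z \<le> B"
    using bdd by (auto simp: bounded_iff)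
  have "d n \<le> B" for n
    using lower[OF x(1), of n] B[of "x n"] x(1)[of n] sub[of 0 n] by auto
  then obtain D where D: "d \<longlonglongrightarrow> D" "\<And>n. d n \<le> D"
    using incseq_convergent[OF \<open>incseq d\<close>] by metis
  \<comment> \<open>Twice the two squared-norm bounds \<open>(D + 1 / Suc n)\<^sup>2\<close>, less
    the lower bound \<open>(2 * d n)\<^sup>2\<close> for the sum; it vanishes in the limit because
    \<open>d\<close> tends to \<open>D\<close>.\<close>
  define \<epsilon> where "\<epsilon> n = 4 * ((D + 1 / Suc n)\<^sup>2 - (d n)\<^sup>2)" for n
  \<comment> \<open>parallelogram law, the midpoint of \<open>x n\<close> and \<open>x m\<close> lying in \<open>C n\<close>\<close>
  have close: "(norm (x n - x m))\<^sup>2 \<le> \<epsilon> n" if "n \<le> m" for n m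
  proof -
    have "(1/2) *\<^sub>R x n + (1/2) *\<^sub>R x m \<in> C n"
      using convexD[OF cvx[of n], of "x n" "x m" "1/2" "1/2"] x(1) sub[OF that] by auto
    from lower[OF this] have "d n \<le> norm (x n + x m) / 2"
      by (metis norm_scaleR scaleR_add_right abs_of_pos half_gt_zero mult.commute
          times_divide_eq_right mult_1_right zero_less_one)
    then have "(2 * d n)\<^sup>2 \<le> (norm (x n + x m))\<^sup>2"
      using d_nonneg[of n] by (intro power_mono) auto
    moreover have "(norm (x n))\<^sup>2 \<le> (D + 1 / Suc n)\<^sup>2"
      using x(2)[of n] D(2)[of n] by (intro power_mono) auto
    moreover have "(norm (x m))\<^sup>2 \<le> (D + 1 / Suc n)\<^sup>2"
    proof (intro power_mono)
      have "1 / real (Suc m) \<le> 1 / real (Suc n)"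
        using that by (simp add: field_simps)
      then show "norm (x m) \<le> D + 1 / Suc n"
        using x(2)[of m] D(2)[of m] by linarith
    qed auto
    moreover have "(norm (x n - x m))\<^sup>2 + (norm (x n + x m))\<^sup>2
        = 2 * (norm (x n))\<^sup>2 + 2 * (norm (x m))\<^sup>2"
      by (simp add: power2_norm_eq_inner inner_simps inner_commute)
    ultimately show ?thesis
      by (simp add: \<epsilon>_def power_mult_distrib)
  qed
  have "(\<lambda>n. 1 / real (Suc n)) \<longlonglongrightarrow> 0"
    using lim_inverse_n' LIMSEQ_Suc by blast
  then have "(\<lambda>n. 4 * ((D + 1 / Suc n)\<^sup>2 - (d n)\<^sup>2)) \<longlonglongrightarrow> 4 * ((D + 0)\<^sup>2 - D\<^sup>2)"
    by (intro tendsto_intros D(1))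
  then have \<epsilon>0: "\<epsilon> \<longlonglongrightarrow> 0"
    by (simp add: \<epsilon>_def[abs_def])
  have "Cauchy x"
  proof (rule metric_CauchyI)
    fix e :: real assume "0 < e"
    then have "eventually (\<lambda>n. \<epsilon> n < (e/2)\<^sup>2) sequentially"
      by (intro order_tendstoD(2)[OF \<epsilon>0]) auto
    then obtain N where N: "\<epsilon> N < (e/2)\<^sup>2"
      by (auto simp: eventually_sequentially)
    have "dist (x N) (x m) < e/2" if "N \<le> m" for m
      using close[OF that] N \<open>0 < e\<close> power2_less_imp_less[of "dist (x N) (x m)" "e/2"]
      by (simp add: dist_norm)
    then show "\<exists>M. \<forall>m\<ge>M. \<forall>n\<ge>M. dist (x m) (x n) < e"
      using dist_triangle_half_r by blast
  qed
  then obtain l where l: "x \<longlonglongrightarrow> l"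
    using Cauchy_convergent convergent_def by blast
  have "l \<in> C n" for n
    using closed_sequentially[OF clo[of n], of "\<lambda>k. x (k + n)" l] LIMSEQ_ignore_initial_segment[OF l]
      x(1) sub[of n] by (metis le_add2 subsetD)
  then show ?thesis by blast
qed

text \<open>Uniform boundedness by Baire category: the closed sets \<open>F n\<close> cover the
  space, so one of them contains a ball, and a bound on a ball of directions bounds the
  norm.\<close>

lemma weakly_bounded_imp_bounded:
  fixes A :: "'a::{real_inner, complete_space} set"
  assumes "\<And>v. \<exists>b. \<forall>z\<in>A. z \<bullet> v \<le> b"
  shows "bounded A"
proof -
  define F where "F n = {v. \<forall>z\<in>A. z \<bullet> v \<le> real n}" for n
  have clo: "closed (F n)" for n
  proof -
    have "F n = (\<Inter>z\<in>A. {v. z \<bullet> v \<le> real n})"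
      by (auto simp: F_def)
    then show ?thesis
      by (auto intro!: closed_Collect_le continuous_intros)
  qed
  have cover: "\<exists>n. v \<in> F n" for v
  proof -
    obtain b where "\<forall>z\<in>A. z \<bullet> v \<le> b" using assms by blast
    moreover obtain n where "b \<le> real n" using real_arch_simple by blast
    ultimately show ?thesis unfolding F_def using order_trans by blast
  qed
  have "\<exists>n. interior (F n) \<noteq> {}"
  proof (rule ccontr)
    assume none: "\<nexists>n. interior (F n) \<noteq> {}"
    have "Met_TC.mtopology interior_of \<Union>(range F) = ({} :: 'a set)"
    proof (rule Met_TC.metric_Baire_category_alt)
      show "Met_TC.mcomplete TYPE('a)"
        by (simp add: mcomplete_iff_complete complete_UNIV)
    qed (use none clo in auto)
    moreover have "\<Union>(range F) = UNIV"
      using cover by auto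
    ultimately show False by simp
  qed
  then obtain n v r where r: "0 < r" "cball v r \<subseteq> F n"
    by (metis ex_in_conv mem_interior_cball)
  \<comment> \<open>The ball is centred at \<open>v\<close>, not at 0; a bound in direction
    \<open>- v\<close> cancels the contribution of the centre.\<close>
  obtain m where m: "- v \<in> F m"
    using cover by blast
  have "norm z \<le> (n + m) / r" if "z \<in> A" for z
  proof (cases "z = 0")
    case True
    then show ?thesis using r by simp
  next
    case False
    have "v + (r / norm z) *\<^sub>R z \<in> F n"
      using r False by (intro subsetD[OF r(2)]) (simp add: dist_norm)
    then have "z \<bullet> v + (r / norm z) * (z \<bullet> z) \<le> n"
      using that by (auto simp: F_def inner_simps)
    moreover have "- (z \<bullet> v) \<le> m"
      using m that by (auto simp: F_def)
    moreover have "(r / norm z) * (z \<bullet> z) = r * norm z"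
      using False by (simp add: dot_square_norm power2_eq_square)
    ultimately show ?thesis using r by (simp add: field_simps)
  qed
  then show ?thesis
    unfolding bounded_iff by blast
qed

section \<open>Fenchel conjugates and tilted level sets\<close>

lemma fenchel_conjugate_finite:
  assumes "proper_closed_convex f" "u \<in> eff_domain (fenchel_conjugate f)"
  obtains g where "fenchel_conjugate f u = ereal g"
proof -
  obtain x where x: "f x < \<infinity>" "f x \<noteq> -\<infinity>"
    using assms(1) by (auto simp: proper_closed_convex_def eff_domain_def)
  have "ereal (x \<bullet> u) - f x \<le> fenchel_conjugate f u"
    unfolding fenchel_conjugate_def by (rule SUP_upper) simp
  then have "fenchel_conjugate f u \<noteq> -\<infinity>"
    using x by (cases "f x") auto
  moreover have "fenchel_conjugate f u < \<infinity>"
    using assms(2) by (simp add: eff_domain_def)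
  ultimately show ?thesis
    using that by (cases "fenchel_conjugate f u") auto
qed

text \<open>The superlevel set of \<open>z \<bullet> u - f z\<close> at height \<open>c\<close>,
  rearranged to avoid subtracting infinite values and to be a preimage of the epigraph. When
  \<open>c\<close> is the conjugate value at \<open>u\<close>, it is the set of maximizers.\<close>

definition tilted_level :: "('a::real_inner \<Rightarrow> ereal) \<Rightarrow> 'a \<Rightarrow> real \<Rightarrow> 'a set" where
  "tilted_level f u c = {z. f z \<le> ereal (z \<bullet> u - c)}"

lemma tilted_level_vimage: "tilted_level f u c = (\<lambda>z. (z, z \<bullet> u - c)) -` ereal_epigraph f"
  by (auto simp: tilted_level_def ereal_epigraph_def)

lemma closed_tilted_level:
  assumes "proper_closed_convex f"
  shows "closed (tilted_level f u c)"
  unfolding tilted_level_vimage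
  using assms by (intro closed_vimage continuous_intros) (auto simp: proper_closed_convex_def)

lemma convex_tilted_level:
  assumes "proper_closed_convex f"
  shows "convex (tilted_level f u c)"
proof (rule convexI)
  fix x y and a b :: real
  assume xy: "x \<in> tilted_level f u c" "y \<in> tilted_level f u c" and ab: "0 \<le> a" "0 \<le> b" "a + b = 1"
  have "a *\<^sub>R (x, x \<bullet> u - c) + b *\<^sub>R (y, y \<bullet> u - c) \<in> ereal_epigraph f"
    using assms xy ab by (intro convexD) (auto simp: proper_closed_convex_def tilted_level_vimage)
  moreover have "a * (x \<bullet> u - c) + b * (y \<bullet> u - c) = (a *\<^sub>R x + b *\<^sub>R y) \<bullet> u - (a + b) * c"
    by (simp add: inner_simps algebra_simps)
  ultimately show "a *\<^sub>R x + b *\<^sub>R y \<in> tilted_level f u c"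
    using ab by (simp add: tilted_level_vimage)
qed

lemma antimono_tilted_level: "c \<le> d \<Longrightarrow> tilted_level f u d \<subseteq> tilted_level f u c"
  by (auto simp: tilted_level_def elim: order_trans)

lemma fenchel_young:
  assumes "fenchel_conjugate f u = ereal g"
  shows "ereal (z \<bullet> u - g) \<le> f z"
proof -
  have "ereal (z \<bullet> u) - f z \<le> ereal g"
    unfolding assms[symmetric] fenchel_conjugate_def by (rule SUP_upper) simp
  then show ?thesis by (cases "f z") auto
qed

lemma tilted_level_nonempty:
  assumes "fenchel_conjugate f u = ereal g" "c < g"
  shows "tilted_level f u c \<noteq> {}"
proof -
  have "ereal c < fenchel_conjugate f u"
    using assms by simp
  then obtain z where "ereal c < ereal (z \<bullet> u) - f z"
    by (auto simp: fenchel_conjugate_def less_SUP_iff)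
  then have "z \<in> tilted_level f u c"
    by (cases "f z") (auto simp: tilted_level_def)
  then show ?thesis by blast
qed

text \<open>Fenchel-Young at \<open>v\<close> against membership in the level set at
  \<open>u\<close>. Varying \<open>v\<close> along a line through \<open>u\<close> gives both the
  boundedness of level sets and the estimates on difference quotients of the conjugate.\<close>

lemma tilted_level_inner_le:
  assumes "z \<in> tilted_level f u c" "fenchel_conjugate f v = ereal g"
  shows "z \<bullet> (v - u) \<le> g - c"
proof -
  have "ereal (z \<bullet> v - g) \<le> ereal (z \<bullet> u - c)"
    using order_trans[OF fenchel_young[OF assms(2)]] assms(1) by (simp only: tilted_level_def mem_Collect_eq)
  then show ?thesis by (simp add: inner_simps)
qed

lemma interior_ray:
  fixes u :: "'a::real_normed_vector"
  assumes "u \<in> interior D"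
  obtains s where "0 < s" "\<And>t. \<bar>t\<bar> \<le> s \<Longrightarrow> u + t *\<^sub>R h \<in> D"
proof -
  obtain r where r: "0 < r" "cball u r \<subseteq> D"
    using assms mem_interior_cball by blast
  \<comment> \<open>The 1 added to \<open>norm h\<close> covers the direction
    \<open>h = 0\<close>.\<close>
  have "u + t *\<^sub>R h \<in> D" if "\<bar>t\<bar> \<le> r / (norm h + 1)" for t
  proof -
    have "\<bar>t\<bar> * norm h \<le> r / (norm h + 1) * (norm h + 1)"
      using that r(1) by (intro mult_mono) auto
    also have "\<dots> = r"
      by (simp add: add_nonneg_eq_0_iff)
    finally show ?thesis
      by (intro subsetD[OF r(2)]) (simp add: dist_norm)
  qed
  then show ?thesis
    using that[of "r / (norm h + 1)"] r(1) by (simp add: add_nonneg_pos)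
qed

text \<open>In each direction \<open>h\<close> the conjugate is still finite at some
  \<open>u + s *\<^sub>R h\<close>, which bounds \<open>z \<bullet> h\<close> from above; weak
  boundedness then suffices.\<close>

lemma bounded_tilted_level:
  fixes f :: "'a::{real_inner, complete_space} \<Rightarrow> ereal"
  assumes "proper_closed_convex f" "u \<in> interior (eff_domain (fenchel_conjugate f))"
  shows "bounded (tilted_level f u c)"
proof (rule weakly_bounded_imp_bounded)
  fix h
  obtain s where s: "0 < s" "u + s *\<^sub>R h \<in> eff_domain (fenchel_conjugate f)"
    by (metis interior_ray[OF assms(2)] abs_of_pos order_refl)
  then obtain g where "fenchel_conjugate f (u + s *\<^sub>R h) = ereal g"
    using assms(1) fenchel_conjugate_finite by blast
  then have "z \<bullet> h \<le> (g - c) / s" if "z \<in> tilted_level f u c" for z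
    using tilted_level_inner_le[OF that] s(1) by (fastforce simp: field_simps)
  then show "\<exists>b. \<forall>z\<in>tilted_level f u c. z \<bullet> h \<le> b"
    by blast
qed

text \<open>Stands in for weak compactness. The set \<open>D\<close> carries a side condition to the
  limit: \<open>UNIV\<close> gives attainment of the conjugate, a half-space gives its
  derivative.\<close>

lemma tilted_level_limit_nonempty:
  fixes f :: "'a::{real_inner, complete_space} \<Rightarrow> ereal"
  assumes pcc: "proper_closed_convex f" and u: "u \<in> interior (eff_domain (fenchel_conjugate f))"
    and D: "closed D" "convex D"
    and ne: "\<And>e. 0 < e \<Longrightarrow> tilted_level f u (c - e) \<inter> D \<noteq> {}"
  shows "tilted_level f u c \<inter> D \<noteq> {}"
proof -
  define C where "C n = tilted_level f u (c - 1 / Suc n) \<inter> D" for n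
  have "(\<Inter>n. C n) \<noteq> {}"
  proof (rule nested_closed_convex_Inter_nonempty)
    show "decseq C"
    proof (rule decseq_SucI)
      fix n
      have "1 / real (Suc (Suc n)) \<le> 1 / real (Suc n)"
        by (simp add: field_simps)
      then show "C (Suc n) \<subseteq> C n"
        unfolding C_def by (intro Int_mono antimono_tilted_level) auto
    qed
    show "C n \<noteq> {}" for n
      unfolding C_def by (rule ne) simp
  qed (auto simp: C_def intro: closed_tilted_level convex_tilted_level bounded_tilted_level
      pcc u D closed_Int convex_Int)
  then obtain z where z: "\<And>n. z \<in> C n"
    by blast
  have "f z \<le> ereal (z \<bullet> u - c)"
  proof (rule tendsto_lowerbound)
    have "(\<lambda>n. z \<bullet> u - (c - 1 / Suc n)) \<longlonglongrightarrow> z \<bullet> u - (c - 0)"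
      using LIMSEQ_Suc[OF lim_inverse_n'] by (intro tendsto_intros) auto
    then show "(\<lambda>n. ereal (z \<bullet> u - (c - 1 / Suc n))) \<longlonglongrightarrow> ereal (z \<bullet> u - c)"
      by simp
    show "\<forall>\<^sub>F n in sequentially. f z \<le> ereal (z \<bullet> u - (c - 1 / Suc n))"
      using z by (intro always_eventually) (auto simp: C_def tilted_level_def)
  qed simp
  then show ?thesis
    using z[of 0] by (auto simp: C_def tilted_level_def)
qed


section \<open>Subgradients and Gateaux gradients\<close>

lemma subdiff_if_fenchel_equality:
  assumes "fenchel_conjugate f u = ereal g" "x \<in> tilted_level f u g"
  shows "u \<in> subdiff f x"
  unfolding subdiff_def
proof safe
  fix y
  have "f x + ereal (u \<bullet> (y - x)) \<le> ereal (x \<bullet> u - g) + ereal (u \<bullet> (y - x))"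
    using assms(2) by (intro add_right_mono) (simp add: tilted_level_def)
  also have "\<dots> = ereal (y \<bullet> u - g)"
    by (simp add: inner_simps inner_commute)
  also have "\<dots> \<le> f y"
    by (rule fenchel_young[OF assms(1)])
  finally show "f x + ereal (u \<bullet> (y - x)) \<le> f y" .
qed

lemma has_gateaux_gradient_unique:
  assumes "has_gateaux_gradient f x u" "has_gateaux_gradient f x w"
  shows "u = w"
proof -
  have "u \<bullet> h = w \<bullet> h" for h
    using assms tendsto_unique[OF at_neq_bot] by (fastforce simp: has_gateaux_gradient_def)
  then show ?thesis
    using vector_eq_rdot by blast
qed

lemma gateaux_gradient_eq: "has_gateaux_gradient f x u \<Longrightarrow> gateaux_gradient f x = u"
  unfolding gateaux_gradient_def using has_gateaux_gradient_unique by blast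

text \<open>The subgradient inequality bounds the right-hand quotients below by
  \<open>u \<bullet> h\<close>; the choice \<open>h = u - w\<close> turns the limit into
  \<open>(u - w) \<bullet> (u - w) \<le> 0\<close>.\<close>

lemma subdiff_eq_gateaux_gradient:
  assumes f: "\<And>x. f x \<noteq> -\<infinity>" and u: "u \<in> subdiff f x" and w: "has_gateaux_gradient f x w"
  shows "w = u"
proof -
  define h where "h = u - w"
  have x: "x \<in> interior (eff_domain f)"
    and lim: "((\<lambda>t. (real_of_ereal (f (x + t *\<^sub>R h)) - real_of_ereal (f x)) / t)
        \<longlongrightarrow> w \<bullet> h) (at 0)"
    using w by (auto simp: has_gateaux_gradient_def)
  obtain s where s: "0 < s" "\<And>t. \<bar>t\<bar> \<le> s \<Longrightarrow> x + t *\<^sub>R h \<in> eff_domain f"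
    using interior_ray[OF x] by blast
  have "u \<bullet> h \<le> w \<bullet> h"
  proof (rule tendsto_lowerbound)
    show "((\<lambda>t. (real_of_ereal (f (x + t *\<^sub>R h)) - real_of_ereal (f x)) / t)
        \<longlongrightarrow> w \<bullet> h) (at_right 0)"
      using lim filterlim_at_split by blast
    have "u \<bullet> h \<le> (real_of_ereal (f (x + t *\<^sub>R h)) - real_of_ereal (f x)) / t"
      if "0 < t" "t < s" for t
    proof -
      have "f x < \<infinity>" "f (x + t *\<^sub>R h) < \<infinity>"
        using s(2)[of 0] s(2)[of t] s(1) that by (auto simp: eff_domain_def)
      moreover have "f x + ereal (u \<bullet> (t *\<^sub>R h)) \<le> f (x + t *\<^sub>R h)"
        using u by (auto simp: subdiff_def dest: spec[of _ "x + t *\<^sub>R h"])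
      ultimately show ?thesis
        using that f[of x] f[of "x + t *\<^sub>R h"]
        by (cases "f x"; cases "f (x + t *\<^sub>R h)") (auto simp: field_simps)
    qed
    then show "\<forall>\<^sub>F t in at_right 0.
        u \<bullet> h \<le> (real_of_ereal (f (x + t *\<^sub>R h)) - real_of_ereal (f x)) / t"
      using s(1) by (auto simp: eventually_at_right)
  qed simp
  then have "(u - w) \<bullet> (u - w) \<le> 0"
    by (simp add: h_def inner_simps inner_commute)
  then show ?thesis
    by (metis inner_ge_zero inner_eq_zero_iff order_antisym right_minus_eq)
qed

section \<open>The maximizer and the gradient of the conjugate\<close>

lemma convex_eff_domain:
  assumes "proper_closed_convex f"
  shows "convex (eff_domain f)"
proof -
  have "eff_domain f = fst ` ereal_epigraph f"
  proof
    show "eff_domain f \<subseteq> fst ` ereal_epigraph f"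
    proof
      fix x assume "x \<in> eff_domain f"
      then have "(x, real_of_ereal (f x)) \<in> ereal_epigraph f"
        using assms by (cases "f x") (auto simp: eff_domain_def ereal_epigraph_def proper_closed_convex_def)
      then show "x \<in> fst ` ereal_epigraph f"
        by (metis fst_conv image_eqI)
    qed
  qed (auto simp: eff_domain_def ereal_epigraph_def)
  then show ?thesis
    using assms convex_linear_image[OF linear_fst] by (auto simp: proper_closed_convex_def)
qed

text \<open>Maximizers lie in the domain of the subdifferential, which essential smoothness
  identifies with the convex set \<open>interior (eff_domain f)\<close>. Strict convexity there
  would put the midpoint of two maximizers below the Fenchel-Young bound.\<close>

lemma legendre_tilted_level_unique:
  assumes pcc: "proper_closed_convex f" and "legendre f" and g: "fenchel_conjugate f u = ereal g"
    and x: "x \<in> tilted_level f u g" and y: "y \<in> tilted_level f u g"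
  shows "x = y"
proof (rule ccontr)
  assume "x \<noteq> y"
  have f_eq: "f z = ereal (z \<bullet> u - g)" if "z \<in> tilted_level f u g" for z
    using that fenchel_young[OF g, of z] by (auto simp: tilted_level_def)
  have dom: "subdiff_domain f = interior (eff_domain f)"
    using assms(2) by (simp add: legendre_def essentially_smooth_def)
  have "x \<in> subdiff_domain f" "y \<in> subdiff_domain f"
    using subdiff_if_fenchel_equality[OF g] x y by (auto simp: subdiff_domain_def)
  moreover have "convex (subdiff_domain f)"
    unfolding dom by (rule convex_interior[OF convex_eff_domain[OF pcc]])
  moreover have "f ((1 - t) *\<^sub>R x + t *\<^sub>R y) < ereal (1 - t) * f x + ereal t * f y"
    if "convex C" "C \<subseteq> subdiff_domain f" "x \<in> C" "y \<in> C" "0 < t" "t < 1" for C t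
    using assms(2) that \<open>x \<noteq> y\<close> unfolding legendre_def essentially_strictly_convex_def by blast
  from this[of "subdiff_domain f" "1/2"]
  have "f ((1 - 1/2) *\<^sub>R x + (1/2) *\<^sub>R y) < ereal (1 - 1/2) * f x + ereal (1/2) * f y"
    using calculation by simp
  moreover have "ereal (((1 - 1/2) *\<^sub>R x + (1/2) *\<^sub>R y) \<bullet> u - g) \<le> f ((1 - 1/2) *\<^sub>R x + (1/2) *\<^sub>R y)"
    by (rule fenchel_young[OF g])
  ultimately have "ereal (((1 - 1/2) *\<^sub>R x + (1/2) *\<^sub>R y) \<bullet> u - g) < ereal (1 - 1/2) * f x + ereal (1/2) * f y"
    by (simp only: order_le_less_trans)
  then show False
    by (simp add: f_eq[OF x] f_eq[OF y] inner_simps field_simps)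
qed

text \<open>If the quotients stayed above \<open>\<langle>x, h\<rangle> + e\<close>, near-maximizers for \<open>u + t h\<close> would give, as \<open>t\<close> tends
  to \<open>0\<close>, a maximizer \<open>z\<close> for \<open>u\<close> with \<open>\<langle>z, h\<rangle> > \<langle>x, h\<rangle>\<close>.\<close>
lemma conjugate_quotient_upper:
  fixes f :: "'a::{real_inner, complete_space} \<Rightarrow> ereal"
  assumes pcc: "proper_closed_convex f" and u: "u \<in> interior (eff_domain (fenchel_conjugate f))"
    and g: "fenchel_conjugate f u = ereal g" and x: "tilted_level f u g = {x}" and "0 < e"
  shows "\<forall>\<^sub>F t in at_right 0. (real_of_ereal (fenchel_conjugate f (u + t *\<^sub>R h)) - g) / t < x \<bullet> h + e"
proof (rule ccontr)
  define c where "c = x \<bullet> h + e"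
  define q where "q t = (real_of_ereal (fenchel_conjugate f (u + t *\<^sub>R h)) - g) / t" for t
  assume "\<not> ?thesis"
  then have large: "\<exists>t>0. t < \<delta> \<and> c \<le> q t" if "0 < \<delta>" for \<delta>
    using that unfolding eventually_at_right_field by (force simp: q_def c_def not_less)
  obtain s where s: "0 < s" "\<And>t. \<bar>t\<bar> \<le> s \<Longrightarrow> u + t *\<^sub>R h \<in> eff_domain (fenchel_conjugate f)"
    using interior_ray[OF u] by blast
  then obtain k where k: "fenchel_conjugate f (u + s *\<^sub>R h) = ereal k"
    using fenchel_conjugate_finite[OF pcc, of "u + s *\<^sub>R h"] by auto
  \<comment> \<open>Halfway between \<open>x \<bullet> h\<close> and \<open>c\<close>: below
    \<open>c\<close>, so that near-maximizers at this height exist, and above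
    \<open>x \<bullet> h\<close>, so that the limiting maximizer cannot be \<open>x\<close>.\<close>
  define c' where "c' = c - e / 2"
  \<comment> \<open>An upper bound for \<open>z \<bullet> h\<close> uniform in \<open>t\<close>,
    from Fenchel-Young at the fixed point \<open>u + s *\<^sub>R h\<close> and
    \<open>s - t \<ge> s / 2\<close>.\<close>
  define B where "B = max 0 (2 * (k - g + s * \<bar>c'\<bar>) / s)"
  have "tilted_level f u g \<inter> {z. c' \<le> z \<bullet> h} \<noteq> {}"
  proof (rule tilted_level_limit_nonempty[OF pcc u])
    show "closed {z. c' \<le> z \<bullet> h}"
      by (intro closed_Collect_le continuous_intros)
    show "convex {z. c' \<le> z \<bullet> h}"
      using convex_halfspace_ge[of c' h] by (simp add: inner_commute)
  next
    fix \<eta> :: real assume "0 < \<eta>"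
    have pos: "0 < B + \<bar>c'\<bar> + 1"
      by (simp add: B_def)
    \<comment> \<open>The first bound on \<open>t\<close> makes \<open>B\<close> valid; the second
      makes the loss from replacing \<open>u + t *\<^sub>R h\<close> by \<open>u\<close> at most
      \<open>\<eta>\<close>.\<close>
    then obtain t where t: "0 < t" "t < min (s / 2) (\<eta> / (B + \<bar>c'\<bar> + 1))" "c \<le> q t"
      using large[of "min (s / 2) (\<eta> / (B + \<bar>c'\<bar> + 1))"] s(1) \<open>0 < \<eta>\<close> by auto
    obtain r where r: "fenchel_conjugate f (u + t *\<^sub>R h) = ereal r"
      using fenchel_conjugate_finite[OF pcc s(2)[of t]] t by auto
    have "g + t * c' < r"
    proof -
      have "t * c \<le> r - g"
        using t(1,3) by (simp add: q_def r field_simps)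
      moreover have "t * c' < t * c"
        using t(1) \<open>0 < e\<close> by (simp add: c'_def)
      ultimately show ?thesis by simp
    qed
    then obtain z where z: "z \<in> tilted_level f (u + t *\<^sub>R h) (g + t * c')"
      using tilted_level_nonempty[OF r] by blast
    have "t * c' \<le> t * (z \<bullet> h)"
      using tilted_level_inner_le[OF z g] by (simp add: algebra_simps)
    then have zh: "c' \<le> z \<bullet> h"
      using t(1) by simp
    have "(s - t) * (z \<bullet> h) \<le> k - g - t * c'"
      using tilted_level_inner_le[OF z k] by (simp add: algebra_simps)
    also have "\<dots> \<le> k - g + s * \<bar>c'\<bar>"
    proof -
      have "- (t * c') \<le> t * \<bar>c'\<bar>"
        using t(1) by (metis abs_ge_minus_self abs_mult abs_of_pos)
      also have "\<dots> \<le> s * \<bar>c'\<bar>"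
        using t s(1) by (intro mult_right_mono) auto
      finally show ?thesis by simp
    qed
    finally have "(s - t) * (z \<bullet> h) \<le> k - g + s * \<bar>c'\<bar>" .
    moreover have "s / 2 * (z \<bullet> h) \<le> (s - t) * (z \<bullet> h)" if "0 \<le> z \<bullet> h"
      using t that by (intro mult_right_mono) auto
    ultimately have "s / 2 * (z \<bullet> h) \<le> k - g + s * \<bar>c'\<bar>" if "0 \<le> z \<bullet> h"
      using that by linarith
    then have "z \<bullet> h \<le> B"
      using s(1) by (cases "0 \<le> z \<bullet> h") (auto simp: B_def le_max_iff_disj field_simps)
    then have "t * (z \<bullet> h - c') \<le> t * (B + \<bar>c'\<bar> + 1)"
      using t(1) by (intro mult_left_mono) auto
    also have "\<dots> \<le> \<eta>"
      using t(2) pos by (simp add: field_simps)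
    finally have "g - \<eta> \<le> g - t * (z \<bullet> h - c')"
      by simp
    \<comment> \<open>The same inequality for \<open>z\<close>, with the term
      \<open>t * (z \<bullet> h)\<close> moved from the tilt into the height.\<close>
    moreover have "z \<in> tilted_level f u (g - t * (z \<bullet> h - c'))"
      using z by (simp add: tilted_level_def algebra_simps)
    ultimately have "z \<in> tilted_level f u (g - \<eta>)"
      using antimono_tilted_level by blast
    then show "tilted_level f u (g - \<eta>) \<inter> {z. c' \<le> z \<bullet> h} \<noteq> {}"
      using zh by blast
  qed
  then show False
    using x \<open>0 < e\<close> by (auto simp: c_def c'_def)
qed

text \<open>Fenchel-Young at \<open>u + t *\<^sub>R h\<close>, applied to the maximizer
  \<open>x\<close>, bounds the right-hand quotients below by \<open>x \<bullet> h\<close>;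
  \<open>conjugate_quotient_upper\<close> supplies the other half.\<close>

lemma conjugate_has_gateaux_gradient:
  fixes f :: "'a::{real_inner, complete_space} \<Rightarrow> ereal"
  assumes pcc: "proper_closed_convex f" and u: "u \<in> interior (eff_domain (fenchel_conjugate f))"
    and g: "fenchel_conjugate f u = ereal g" and x: "tilted_level f u g = {x}"
  shows "has_gateaux_gradient (fenchel_conjugate f) u x"
proof -
  define q where "q h t = (real_of_ereal (fenchel_conjugate f (u + t *\<^sub>R h)) - g) / t" for h t
  have right: "(q h \<longlongrightarrow> x \<bullet> h) (at_right 0)" for h
  proof (rule order_tendstoI)
    fix a assume "x \<bullet> h < a"
    then show "\<forall>\<^sub>F t in at_right 0. q h t < a"
      using conjugate_quotient_upper[OF pcc u g x, of "a - x \<bullet> h" h] by (simp add: q_def)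
  next
    fix a assume a: "a < x \<bullet> h"
    obtain s where s: "0 < s" "\<And>t. \<bar>t\<bar> \<le> s \<Longrightarrow> u + t *\<^sub>R h \<in> eff_domain (fenchel_conjugate f)"
      using interior_ray[OF u] by blast
    have "a < q h t" if t: "0 < t" "t < s" for t
    proof -
      obtain r where r: "fenchel_conjugate f (u + t *\<^sub>R h) = ereal r"
        using fenchel_conjugate_finite[OF pcc s(2)[of t]] t by auto
      have "x \<bullet> h \<le> q h t"
        using tilted_level_inner_le[OF _ r, of x u g] x t(1) by (simp add: q_def r field_simps)
      then show ?thesis using a by simp
    qed
    then show "\<forall>\<^sub>F t in at_right 0. a < q h t"
      using s(1) by (auto simp: eventually_at_right)
  qed
  have "(q h \<longlongrightarrow> x \<bullet> h) (at 0)" for h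
  proof -
    \<comment> \<open>The left-hand quotient in direction \<open>h\<close> is minus the right-hand
      quotient in direction \<open>- h\<close>.\<close>
    have "((\<lambda>t. - q (- h) t) \<longlongrightarrow> - (x \<bullet> (- h))) (at_right 0)"
      by (intro tendsto_minus right)
    then have "(q h \<longlongrightarrow> x \<bullet> h) (at_left 0)"
      unfolding filterlim_at_left_to_right by (simp add: q_def[abs_def])
    then show ?thesis
      using right by (simp add: filterlim_at_split)
  qed
  then show ?thesis
    using u by (simp add: has_gateaux_gradient_def q_def[abs_def] g)
qed

text \<open>The unique maximizer is the gradient of the conjugate at \<open>u\<close>, and
  \<open>u\<close> is a subgradient of \<open>f\<close> there; essential smoothness then gives both
  interiority and differentiability.\<close>

lemma legendre_conjugate_gradient:
  fixes f :: "'a::{real_inner, complete_space} \<Rightarrow> ereal"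
  assumes pcc: "proper_closed_convex f" and leg: "legendre f"
    and u: "u \<in> interior (eff_domain (fenchel_conjugate f))"
  defines "x \<equiv> gateaux_gradient (fenchel_conjugate f) u"
  shows "x \<in> interior (eff_domain f)" and "gateaux_gradient f x = u"
proof -
  obtain g where g: "fenchel_conjugate f u = ereal g"
    using fenchel_conjugate_finite[OF pcc] u interior_subset by blast
  have "tilted_level f u g \<inter> UNIV \<noteq> {}"
    by (rule tilted_level_limit_nonempty[OF pcc u]) (use tilted_level_nonempty[OF g] in auto)
  then obtain y where y: "tilted_level f u g = {y}"
    using legendre_tilted_level_unique[OF pcc leg g] by blast
  then have xy: "x = y"
    unfolding x_def by (intro gateaux_gradient_eq conjugate_has_gateaux_gradient[OF pcc u g])
  have "u \<in> subdiff f x"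
    using subdiff_if_fenchel_equality[OF g] y xy by blast
  then show x: "x \<in> interior (eff_domain f)"
    using leg by (auto simp: legendre_def essentially_smooth_def subdiff_domain_def)
  then obtain w where w: "has_gateaux_gradient f x w"
    using leg unfolding legendre_def essentially_smooth_def by blast
  moreover have "w = u"
    using subdiff_eq_gateaux_gradient[OF _ \<open>u \<in> subdiff f x\<close> w] pcc
    by (auto simp: proper_closed_convex_def)
  ultimately show "gateaux_gradient f x = u"
    using gateaux_gradient_eq by blast
qed

section \<open>Equidistance, Gram matrices and affine coordinates\<close>

lemma bregman_distance_eq_iff:
  assumes f: "\<And>x. f x \<noteq> -\<infinity>" and dom: "p \<in> eff_domain f" "q \<in> eff_domain f"
    and y: "y \<in> interior (eff_domain f)"
  shows "bregman_distance f p y = bregman_distance f q y \<longleftrightarrow>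
    gateaux_gradient f y \<bullet> (p - q) = real_of_ereal (f p) - real_of_ereal (f q)"
proof -
  have fin: "f z = ereal (real_of_ereal (f z))" if "z \<in> eff_domain f" for z
    using that f[of z] by (cases "f z") (auto simp: eff_domain_def)
  have "y \<in> eff_domain f"
    using y interior_subset by blast
  from fin[OF this] fin[OF dom(1)] fin[OF dom(2)] obtain a b c where
    "f y = ereal a" "f p = ereal b" "f q = ereal c" by blast
  then show ?thesis
    using y by (auto simp: bregman_distance_def inner_simps)
qed

lemma gram_matrix_mult_vec: "gram_matrix a *v \<beta> = (\<chi> i. (\<Sum>j\<in>UNIV. (\<beta> $ j) *\<^sub>R a j) \<bullet> a i)"
  by (simp add: gram_matrix_def matrix_vector_mult_def vec_eq_iff inner_sum_left inner_commute[of "a _" "a _"] mult.commute)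

text \<open>A kernel vector gives a combination \<open>v\<close> of the \<open>a i\<close>
  orthogonal to every \<open>a i\<close>, hence to itself.\<close>

lemma invertible_gram_matrix:
  assumes "\<And>\<beta>. (\<Sum>i\<in>UNIV. (\<beta> $ i) *\<^sub>R a i) = 0 \<Longrightarrow> \<beta> = 0"
  shows "invertible (gram_matrix a)"
  unfolding invertible_left_inverse matrix_left_invertible_ker
proof (intro allI impI)
  fix \<beta> assume 0: "gram_matrix a *v \<beta> = 0"
  define v where "v = (\<Sum>i\<in>UNIV. (\<beta> $ i) *\<^sub>R a i)"
  have "v \<bullet> a i = 0" for i
    using 0 by (simp add: gram_matrix_mult_vec v_def vec_eq_iff)
  then have "v \<bullet> v = 0"
    by (subst (2) v_def) (simp add: inner_sum_right)
  then show "\<beta> = 0"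
    using assms by (simp add: v_def)
qed

text \<open>Affine independence is linear independence of the differences from \<open>p0\<close>. As
  \<open>affine_dependent\<close> speaks of sets, \<open>inj p\<close> and
  \<open>p0 \<notin> range p\<close> exclude repetitions in the indexed family.\<close>

lemma affine_independent_combination_zero:
  fixes p :: "'m::finite \<Rightarrow> 'a::real_vector" and \<beta> :: "real ^ 'm"
  assumes ind: "\<not> affine_dependent (insert p0 (range p))" and "p0 \<notin> range p" "inj p"
    and 0: "(\<Sum>i\<in>UNIV. (\<beta> $ i) *\<^sub>R (p i - p0)) = 0"
  shows "\<beta> = 0"
proof -
  have inj: "inj (\<lambda>i. p i - p0)"
    using \<open>inj p\<close> by (auto simp: inj_def)
  \<comment> \<open>Coefficients carried from indices to vectors, as \<open>independentD\<close>
    expects.\<close>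
  define c where "c v = \<beta> $ inv (\<lambda>i. p i - p0) v" for v
  have "independent (range (\<lambda>i. p i - p0))"
    using ind affine_dependent_iff_dependent[OF \<open>p0 \<notin> range p\<close>] by (simp add: image_image)
  moreover have "(\<Sum>v\<in>range (\<lambda>i. p i - p0). c v *\<^sub>R v) = 0"
    by (subst sum.reindex[OF inj]) (use 0 in \<open>simp add: c_def inv_f_f[OF inj]\<close>)
  ultimately have "c (p i - p0) = 0" for i
    by (intro independentD[of "range (\<lambda>i. p i - p0)" "range (\<lambda>i. p i - p0)"]) auto
  then show ?thesis
    by (simp add: c_def inv_f_f[OF inj] vec_eq_iff)
qed

lemma affine_hull_insert_range:
  fixes p :: "'m::finite \<Rightarrow> 'a::real_vector"
  shows "affine hull (insert p0 (range p)) =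
    range (\<lambda>\<beta> :: real ^ 'm. p0 + (\<Sum>i\<in>UNIV. (\<beta> $ i) *\<^sub>R (p i - p0)))"
proof -
  have "span (range (\<lambda>i. p i - p0)) = range (\<lambda>\<beta> :: real ^ 'm. \<Sum>i\<in>UNIV. (\<beta> $ i) *\<^sub>R (p i - p0))"
    (is "_ = ?R")
  proof
    have "subspace ?R"
      unfolding subspace_def
    proof (intro conjI ballI allI)
      show "0 \<in> ?R" by (rule image_eqI[of _ _ 0]) auto
    next
      fix v w assume "v \<in> ?R" "w \<in> ?R"
      then obtain \<beta> \<gamma> :: "real ^ 'm" where "v = (\<Sum>i\<in>UNIV. (\<beta> $ i) *\<^sub>R (p i - p0))"
        "w = (\<Sum>i\<in>UNIV. (\<gamma> $ i) *\<^sub>R (p i - p0))" by blast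
      then have "v + w = (\<Sum>i\<in>UNIV. ((\<beta> + \<gamma>) $ i) *\<^sub>R (p i - p0))"
        by (simp add: scaleR_add_left sum.distrib)
      then show "v + w \<in> ?R" by blast
    next
      fix r v assume "v \<in> ?R"
      then obtain \<beta> :: "real ^ 'm" where "v = (\<Sum>i\<in>UNIV. (\<beta> $ i) *\<^sub>R (p i - p0))" by blast
      then have "r *\<^sub>R v = (\<Sum>i\<in>UNIV. ((r *\<^sub>R \<beta>) $ i) *\<^sub>R (p i - p0))"
        by (simp add: scaleR_sum_right)
      then show "r *\<^sub>R v \<in> ?R" by blast
    qed
    moreover have "range (\<lambda>i. p i - p0) \<subseteq> ?R"
    proof safe
      fix j
      have "(\<Sum>i\<in>UNIV. (axis j (1::real) $ i) *\<^sub>R (p i - p0)) = (\<Sum>i\<in>UNIV. if i = j then p i - p0 else 0)"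
        by (intro sum.cong) (auto simp: axis_def)
      then show "p j - p0 \<in> ?R"
        by (intro image_eqI[of _ _ "axis j 1"]) auto
    qed
    ultimately show "span (range (\<lambda>i. p i - p0)) \<subseteq> ?R"
      by (rule span_minimal[rotated])
    show "?R \<subseteq> span (range (\<lambda>i. p i - p0))"
      by (auto intro!: span_sum span_scale intro: span_base)
  qed
  then show ?thesis
    by (simp add: affine_hull_insert_span_gen image_image)
qed

section \<open>Reduction to the Gram system\<close>

theorem theorem4p12:
  fixes f :: "'a::{real_inner, complete_space} \<Rightarrow> ereal"
    and p0 :: 'a and p :: "'m::finite \<Rightarrow> 'a"
    and S :: "'a set" and \<eta> :: "'m \<Rightarrow> real" and \<alpha> :: "real ^ 'm"
  assumes "proper_closed_convex f"
    and "legendre f"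
    and S: "S = insert p0 (range p)"
    and "S \<subseteq> eff_domain f"
    and "p0 \<notin> range p" and "inj p" and "\<not> affine_dependent S"
    and "affine hull S \<subseteq> interior (eff_domain (fenchel_conjugate f))"
    and eta: "\<And>i. \<eta> i = real_of_ereal (f (p i)) - real_of_ereal (f p0)"
    and alpha: "\<alpha> = matrix_inv (gram_matrix (\<lambda>i. p i - p0))
                      *v (\<chi> i. \<eta> i - p0 \<bullet> (p i - p0))"
  shows "invertible (gram_matrix (\<lambda>i. p i - p0))
    \<and> forward_pseudo_circumcenters f S \<noteq> {}
    \<and> forward_pseudo_circumcenters f S =
        {gateaux_gradient (fenchel_conjugate f)
           (p0 + (\<Sum>i\<in>UNIV. (\<alpha> $ i) *\<^sub>R (p i - p0)))}"
proof -
  define G where "G = gram_matrix (\<lambda>i. p i - p0)"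
  define b :: "real ^ 'm" where "b = (\<chi> i. \<eta> i - p0 \<bullet> (p i - p0))"
  define pt where "pt \<beta> = p0 + (\<Sum>i\<in>UNIV. (\<beta> $ i) *\<^sub>R (p i - p0))" for \<beta> :: "real ^ 'm"
  have inv: "invertible G"
    unfolding G_def
    using affine_independent_combination_zero[of p0 p] assms(5-7) S
    by (intro invertible_gram_matrix) blast
  have hull: "affine hull S = range pt"
    unfolding S pt_def[abs_def] by (rule affine_hull_insert_range)
  have linear_system: "pt \<beta> \<bullet> (p i - p0) = \<eta> i \<longleftrightarrow> (G *v \<beta>) $ i = b $ i" for \<beta> i
    by (auto simp: pt_def G_def b_def gram_matrix_mult_vec inner_add_left)
  have solution: "G *v \<beta> = b \<longleftrightarrow> \<beta> = \<alpha>" for \<beta>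
  proof -
    \<comment> \<open>\<open>matrix_inv\<close> is a Hilbert choice; invertibility makes it a
      genuine two-sided inverse.\<close>
    have "matrix_inv G ** G = mat 1" "G ** matrix_inv G = mat 1"
      using inv someI_ex[of "\<lambda>B. G ** B = mat 1 \<and> B ** G = mat 1"]
      by (auto simp: invertible_def matrix_inv_def)
    then show ?thesis
      unfolding alpha G_def[symmetric] b_def[symmetric]
      by (metis matrix_vector_mul_assoc matrix_vector_mul_lid)
  qed
  have equidistant: "gateaux_gradient (fenchel_conjugate f) (pt \<beta>) \<in> forward_equidistant f S \<longleftrightarrow> \<beta> = \<alpha>"
    for \<beta>
  proof -
    define y where "y = gateaux_gradient (fenchel_conjugate f) (pt \<beta>)"
    have "pt \<beta> \<in> interior (eff_domain (fenchel_conjugate f))"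
      using assms(8) hull by blast
    note y = legendre_conjugate_gradient[OF assms(1,2) this, folded y_def]
    \<comment> \<open>Comparing with \<open>p0\<close> alone suffices; since the gradient of
      \<open>f\<close> at \<open>y\<close> is \<open>pt \<beta>\<close>, each comparison becomes one
      row of the system.\<close>
    have "y \<in> forward_equidistant f S \<longleftrightarrow> (\<forall>i. bregman_distance f (p i) y = bregman_distance f p0 y)"
      unfolding forward_equidistant_def S using y(1) by auto
    also have "\<dots> \<longleftrightarrow> (\<forall>i. pt \<beta> \<bullet> (p i - p0) = \<eta> i)"
      using bregman_distance_eq_iff[of f, OF _ _ _ y(1)] assms(1,4)
      by (simp add: S y(2) eta proper_closed_convex_def subset_iff)
    also have "\<dots> \<longleftrightarrow> G *v \<beta> = b"
      by (simp add: linear_system vec_eq_iff)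
    finally show ?thesis
      by (simp add: solution y_def)
  qed
  have "forward_pseudo_circumcenters f S =
      gateaux_gradient (fenchel_conjugate f) ` range pt \<inter> forward_equidistant f S"
    using assms(8) by (simp add: forward_pseudo_circumcenters_def hull Int_absorb2)
  \<comment> \<open>Existence and uniqueness together: \<open>\<alpha>\<close> is the only parameter
    whose image is equidistant.\<close>
  also have "\<dots> = {gateaux_gradient (fenchel_conjugate f) (pt \<alpha>)}"
    using equidistant by auto
  finally show ?thesis
    using inv by (simp add: G_def pt_def)
qed

end
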